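(* Let $S=[s_{ij}]$ be an $n\times n$ generalized Laplacian matrix. If $a,b>0$, define $$d_{ij}:=a^2 s_{ii}+b^2 s_{jj}-2ab\,s_{ij},\qquad f_{ij}:=\max(d_{ij},d_{ji})\qquad (i,j=1,\dots,n),$$ $$D:=[d_{ij}]\quad\text{and}\quad F:=[f_{ij}].$$ If $\mathrm{rank}(S)=n-1$, then each $f_{ij}>0$ and $\left[\frac{1}{f_{ij}}\right]$ is an infinitely divisible matrix.
   Context: All matrices are real. $\mathbf{1}\in\mathbb{R}^n$ is the vector of all ones. An $n\times n$ real symmetric matrix $S$ is a generalized Laplacian matrix if $S$ is positive semidefinite and $S\mathbf{1}=0$. A symmetric matrix $E=[e_{ij}]$ is infinitely divisible if it is entrywise nonnegative and $[e_{ij}^{r}]$ (entrywise power) is a positive semidefinite matrix for all real $r\ge 0$.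
   Formalization: The formal theorem additionally assumes a ≠ b and n ≥ 2; otherwise the claim fails, since f_ii = (a−b)² s_ii is 0 when a = b, and S = 0 gives f_11 = 0 when n = 1. *)

theory Defs
  imports "HOL-Analysis.Analysis"
begin

definition psd_matrix :: "real^'n^'n \<Rightarrow> bool" where
  "psd_matrix A \<longleftrightarrow> transpose A = A \<and> (\<forall>x. 0 \<le> x \<bullet> (A *v x))"

text \<open>The vector \<open>1\<close> below is the componentwise unit, i.e. the vector of all ones.\<close>

definition generalized_Laplacian :: "real^'n^'n \<Rightarrow> bool" where
  "generalized_Laplacian S \<longleftrightarrow> transpose S = S \<and> psd_matrix S \<and> S *v 1 = 0"

text \<open>The library has \<open>0 powr 0 = 0\<close>, where the convention \<open>0\<^sup>0 = 1\<close> is also common. The choice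
  does not affect \<open>infinitely_divisible\<close>: under \<open>0\<^sup>0 = 1\<close> the case \<open>r = 0\<close> holds trivially (the
  all-ones matrix), and under \<open>0\<^sup>0 = 0\<close> it follows from the cases \<open>r > 0\<close> by letting \<open>r\<close> tend to 0.\<close>

definition entrywise_powr :: "real^'n^'n \<Rightarrow> real \<Rightarrow> real^'n^'n" where
  "entrywise_powr E r = (\<chi> i j. (E $ i $ j) powr r)"

definition infinitely_divisible :: "real^'n^'n \<Rightarrow> bool" where
  "infinitely_divisible E \<longleftrightarrow>
     transpose E = E \<and> (\<forall>i j. 0 \<le> E $ i $ j) \<and> (\<forall>r\<ge>0. psd_matrix (entrywise_powr E r))"

definition D_matrix :: "real \<Rightarrow> real \<Rightarrow> real^'n^'n \<Rightarrow> real^'n^'n" where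
  "D_matrix a b S = (\<chi> i j. a\<^sup>2 * S $ i $ i + b\<^sup>2 * S $ j $ j - 2 * a * b * S $ i $ j)"

definition F_matrix :: "real \<Rightarrow> real \<Rightarrow> real^'n^'n \<Rightarrow> real^'n^'n" where
  "F_matrix a b S = (\<chi> i j. max (D_matrix a b S $ i $ j) (D_matrix a b S $ j $ i))"

end

theory Submission imports Defs begin

text \<open>Write \<open>s\<^sub>i = S\<^sub>i\<^sub>i\<close>. Since \<open>max x y + min x y = x + y\<close>, one has
  \<open>F\<^sub>i\<^sub>j = M s\<^sub>i + M s\<^sub>j - P\<^sub>i\<^sub>j\<close> with \<open>M = max a\<^sup>2 b\<^sup>2\<close> and
  \<open>P\<^sub>i\<^sub>j = \<bar>a\<^sup>2 - b\<^sup>2\<bar> min s\<^sub>i s\<^sub>j + 2 a b S\<^sub>i\<^sub>j\<close>, which is positive semidefinite. By the Schur product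
  theorem \<open>exp (- t F\<^sub>i\<^sub>j) = exp (- t M s\<^sub>i) exp (- t M s\<^sub>j) exp (t P\<^sub>i\<^sub>j)\<close> is positive semidefinite
  for \<open>t \<ge> 0\<close>, hence so is the mixture
  \<open>F\<^sub>i\<^sub>j powr - r = (1 / \<Gamma>(r)) \<integral> t powr (r - 1) exp (- t F\<^sub>i\<^sub>j) dt\<close> over \<open>t \<ge> 0\<close>. The rank condition
  makes every \<open>s\<^sub>i\<close>, and therefore every \<open>F\<^sub>i\<^sub>j\<close>, positive.\<close>

section \<open>Positive semidefinite matrices\<close>

lemma inner_matrix_vector_mult:
  fixes A :: "real^'n^'m"
  shows "x \<bullet> (A *v y) = (\<Sum>i\<in>UNIV. \<Sum>j\<in>UNIV. x $ i * y $ j * A $ i $ j)"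
  by (simp add: inner_vec_def matrix_vector_mult_def sum_distrib_left mult_ac)

lemma psd_matrix_iff:
  fixes A :: "real^'n^'n"
  shows "psd_matrix A \<longleftrightarrow> (\<forall>i j. A $ i $ j = A $ j $ i) \<and>
    (\<forall>x :: real^'n. 0 \<le> (\<Sum>i\<in>UNIV. \<Sum>j\<in>UNIV. x $ i * x $ j * A $ i $ j))"
  by (auto simp: psd_matrix_def inner_matrix_vector_mult transpose_def vec_eq_iff)

lemma psd_matrix_add:
  assumes "psd_matrix A" "psd_matrix B"
  shows "psd_matrix (\<chi> i j. A $ i $ j + B $ i $ j)"
  using assms unfolding psd_matrix_iff by (simp add: distrib_left sum.distrib)

lemma psd_matrix_scale:
  assumes "psd_matrix A" "0 \<le> c"
  shows "psd_matrix (\<chi> i j. c * A $ i $ j)"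
  using assms unfolding psd_matrix_iff
  by (simp add: mult.left_commute[of _ c] flip: sum_distrib_left)

text \<open>With G the diagonal matrix of \<open>g\<close> this is G A G, whose form at x is the
  form of \<open>A\<close> at G x.\<close>

lemma psd_matrix_congruence:
  assumes "psd_matrix A"
  shows "psd_matrix (\<chi> i j. g i * g j * A $ i $ j)"
  unfolding psd_matrix_iff
proof (intro conjI allI)
  fix x :: "real^'a"
  have "0 \<le> (\<Sum>i\<in>UNIV. \<Sum>j\<in>UNIV. (\<chi> i. x $ i * g i) $ i * (\<chi> i. x $ i * g i) $ j * A $ i $ j)"
    using assms unfolding psd_matrix_iff by blast
  then show "0 \<le> (\<Sum>i\<in>UNIV. \<Sum>j\<in>UNIV. x $ i * x $ j * (\<chi> i j. g i * g j * A $ i $ j) $ i $ j)"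
    by (simp add: mult_ac)
qed (use assms in \<open>auto simp: psd_matrix_iff mult_ac\<close>)

lemma psd_matrix_one: "psd_matrix (\<chi> (i::'n::finite) j. 1)"
proof -
  have "(\<Sum>i\<in>UNIV. \<Sum>j\<in>UNIV. x $ i * x $ j) = (\<Sum>i\<in>UNIV. x $ i)\<^sup>2" for x :: "real^'n"
    by (simp add: power2_eq_square sum_product)
  then show ?thesis by (simp add: psd_matrix_iff)
qed

lemma psd_matrix_LIMSEQ:
  assumes psd: "\<And>n. psd_matrix (X n)"
    and lim: "\<And>i j. (\<lambda>n. X n $ i $ j) \<longlonglongrightarrow> A $ i $ j"
  shows "psd_matrix A"
  unfolding psd_matrix_iff
proof (intro conjI allI)
  fix i j
  have "(\<lambda>n. X n $ i $ j) = (\<lambda>n. X n $ j $ i)"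
    using psd by (auto simp: psd_matrix_iff)
  then show "A $ i $ j = A $ j $ i"
    using lim[of i j] lim[of j i] LIMSEQ_unique by metis
next
  fix x :: "real^'a"
  have "(\<lambda>n. \<Sum>i\<in>UNIV. \<Sum>j\<in>UNIV. x $ i * x $ j * X n $ i $ j)
      \<longlonglongrightarrow> (\<Sum>i\<in>UNIV. \<Sum>j\<in>UNIV. x $ i * x $ j * A $ i $ j)"
    by (intro tendsto_intros lim)
  then show "0 \<le> (\<Sum>i\<in>UNIV. \<Sum>j\<in>UNIV. x $ i * x $ j * A $ i $ j)"
    by (rule LIMSEQ_le_const) (use psd in \<open>auto simp: psd_matrix_iff\<close>)
qed

lemma psd_matrix_has_integral:
  fixes k :: "real \<Rightarrow> real^'n^'n"
  assumes psd: "\<And>t. t \<in> T \<Longrightarrow> psd_matrix (k t)"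
    and int: "\<And>i j. ((\<lambda>t. k t $ i $ j) has_integral A $ i $ j) T"
  shows "psd_matrix A"
  unfolding psd_matrix_iff
proof (intro conjI allI)
  fix i j
  have "((\<lambda>t. k t $ i $ j) has_integral A $ j $ i) T"
    by (rule has_integral_eq[OF _ int[of j i]]) (use psd in \<open>auto simp: psd_matrix_iff\<close>)
  then show "A $ i $ j = A $ j $ i"
    using int has_integral_unique by blast
next
  fix x :: "real^'n"
  have "((\<lambda>t. \<Sum>i\<in>UNIV. \<Sum>j\<in>UNIV. x $ i * x $ j * k t $ i $ j) has_integral
      (\<Sum>i\<in>UNIV. \<Sum>j\<in>UNIV. x $ i * x $ j * A $ i $ j)) T"
    by (intro has_integral_sum has_integral_mult_right int) auto
  then show "0 \<le> (\<Sum>i\<in>UNIV. \<Sum>j\<in>UNIV. x $ i * x $ j * A $ i $ j)"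
    by (rule has_integral_nonneg) (use psd in \<open>auto simp: psd_matrix_iff\<close>)
qed

text \<open>Expansion of the form at \<open>x + c *\<^sub>R axis p 1\<close>. Choices of
  \<open>c\<close> give the diagonal, zero pivot and Schur complement facts below.\<close>

lemma psd_matrix_shift_axis:
  fixes A :: "real^'n^'n"
  assumes "psd_matrix A"
  shows "0 \<le> x \<bullet> (A *v x) + 2 * c * (A *v x) $ p + c\<^sup>2 * A $ p $ p"
proof -
  let ?e = "axis p 1 :: real^'n"
  have symm: "transpose A = A" using assms by (simp add: psd_matrix_def)
  have e: "?e \<bullet> (A *v y) = (A *v y) $ p" for y
    by (simp add: inner_axis')
  have x: "x \<bullet> (A *v ?e) = (A *v x) $ p"
    using dot_lmul_matrix[of x A ?e] symm e[of x]
    by (metis inner_commute transpose_matrix_vector)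
  have pp: "(A *v ?e) $ p = A $ p $ p"
    by (simp add: matrix_vector_mult_basis column_def)
  have "0 \<le> (x + c *\<^sub>R ?e) \<bullet> (A *v (x + c *\<^sub>R ?e))"
    using assms by (simp add: psd_matrix_def)
  also have "\<dots> = x \<bullet> (A *v x) + 2 * c * (A *v x) $ p + c\<^sup>2 * A $ p $ p"
    by (simp add: matrix_vector_right_distrib matrix_vector_mult_scaleR inner_add_left
        inner_add_right e x pp power2_eq_square algebra_simps)
  finally show ?thesis .
qed

lemma psd_matrix_diag_nonneg: "psd_matrix A \<Longrightarrow> 0 \<le> A $ p $ p"
  using psd_matrix_shift_axis[of A 0 1 p] by simp

lemma psd_matrix_mult_vec_eq_0:
  assumes psd: "psd_matrix A" and 0: "A $ p $ p = 0"
  shows "(A *v x) $ p = 0"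
proof (rule ccontr)
  let ?q = "x \<bullet> (A *v x)" and ?y = "(A *v x) $ p"
  assume "?y \<noteq> 0"
  \<comment> \<open>With a zero pivot the shifted form is affine in \<open>c\<close>; this
    \<open>c\<close> gives it the value -1.\<close>
  then show False
    using psd_matrix_shift_axis[OF psd, of x "- (?q + 1) / (2 * ?y)" p] 0 by (simp add: field_simps)
qed

lemma psd_matrix_row_eq_0:
  assumes "psd_matrix A" "A $ p $ p = 0"
  shows "A $ p $ j = 0"
  using psd_matrix_mult_vec_eq_0[OF assms, of "axis j 1"]
  by (simp add: matrix_vector_mult_basis column_def)

lemma psd_matrix_Schur_complement:
  assumes psd: "psd_matrix A"
  shows "psd_matrix (\<chi> i j. A $ i $ j - A $ i $ p * A $ j $ p / A $ p $ p)"
proof (cases "A $ p $ p = 0")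
  case True
  \<comment> \<open>Division by 0 yields 0, so the matrix is \<open>A\<close> itself.\<close>
  then show ?thesis using psd by (simp add: vec_lambda_eta)
next
  case False
  show ?thesis
    unfolding psd_matrix_iff
  proof (intro conjI allI)
    fix x :: "real^'a"
    let ?y = "(A *v x) $ p"
    have symm: "A $ i $ j = A $ j $ i" for i j using psd by (simp add: psd_matrix_iff)
    have y: "?y = (\<Sum>i\<in>UNIV. x $ i * A $ i $ p)"
      by (simp add: matrix_vector_mult_def symm[of p] mult_ac)
    \<comment> \<open>The minimum of the shifted form over \<open>c\<close>, attained at
      \<open>- ?y / A $ p $ p\<close>.\<close>
    have "0 \<le> x \<bullet> (A *v x) - ?y\<^sup>2 / A $ p $ p"
      using psd_matrix_shift_axis[OF psd, of x "- ?y / A $ p $ p" p] False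
      by (simp add: field_simps power2_eq_square)
    also have "\<dots> = (\<Sum>i\<in>UNIV. \<Sum>j\<in>UNIV. x $ i * x $ j *
        (\<chi> i j. A $ i $ j - A $ i $ p * A $ j $ p / A $ p $ p) $ i $ j)"
      unfolding y
      by (simp add: inner_matrix_vector_mult power2_eq_square sum_product sum_divide_distrib
          right_diff_distrib sum_subtractf mult_ac)
    finally show "0 \<le> \<dots>" .
  qed (use psd in \<open>auto simp: psd_matrix_iff\<close>)
qed

text \<open>Schur product theorem: splitting off the rank one matrix of a pivot \<open>p\<close> (as in the Cholesky
  decomposition) leaves a positive semidefinite matrix whose row and column \<open>p\<close> vanish.\<close>

lemma psd_matrix_Schur_product:
  assumes "psd_matrix A" "psd_matrix B"
  shows "psd_matrix (\<chi> i j. A $ i $ j * B $ i $ j)"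
proof -
  \<comment> \<open>Induction over a set \<open>T\<close> containing the index of every nonzero row
    of \<open>A\<close>; each pivot removes one index.\<close>
  have "psd_matrix (\<chi> i j. A $ i $ j * B $ i $ j)"
    if "finite T" "psd_matrix A" "\<And>i j. A $ i $ j \<noteq> 0 \<Longrightarrow> i \<in> T" for T and A :: "real^'a^'a"
    using that
  proof (induction T arbitrary: A rule: finite_induct)
    case empty
    then have "A $ i $ j = 0" for i j by blast
    then show ?case by (simp add: psd_matrix_iff)
  next
    case (insert p T)
    have symm: "A $ i $ j = A $ j $ i" for i j
      using insert.prems by (simp add: psd_matrix_iff)
    define C where "C = (\<chi> i j. A $ i $ j - A $ i $ p * A $ j $ p / A $ p $ p)"
    have "psd_matrix (\<chi> i j. C $ i $ j * B $ i $ j)"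
    proof (rule insert.IH)
      show "psd_matrix C"
        unfolding C_def by (rule psd_matrix_Schur_complement) (rule insert.prems)
      fix i j
      assume C: "C $ i $ j \<noteq> 0"
      have "i \<noteq> p"
      proof
        assume "i = p"
        \<comment> \<open>A zero pivot forces row \<open>p\<close> of \<open>A\<close> to vanish;
          otherwise the subtraction cancels that row.\<close>
        then show False
          using C psd_matrix_row_eq_0[OF insert.prems(1), of p j] symm[of p j]
          by (cases "A $ p $ p = 0") (auto simp: C_def)
      qed
      moreover have "A $ i $ j \<noteq> 0 \<or> A $ i $ p \<noteq> 0"
        using C by (auto simp: C_def)
      ultimately show "i \<in> T"
        using insert.prems(2) by blast
    qed
    \<comment> \<open>The rank one part times \<open>B\<close> is a diagonal congruence of
      \<open>B\<close> with weights \<open>A $ i $ p\<close>.\<close>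
    moreover have "psd_matrix (\<chi> i j. 1 / A $ p $ p * (\<chi> i j. A $ i $ p * A $ j $ p * B $ i $ j) $ i $ j)"
      by (intro psd_matrix_scale psd_matrix_congruence assms(2))
        (simp add: psd_matrix_diag_nonneg insert.prems)
    ultimately have "psd_matrix (\<chi> i j. (\<chi> i j. C $ i $ j * B $ i $ j) $ i $ j +
        (\<chi> i j. 1 / A $ p $ p * (\<chi> i j. A $ i $ p * A $ j $ p * B $ i $ j) $ i $ j) $ i $ j)"
      by (rule psd_matrix_add)
    then show ?case by (simp add: C_def algebra_simps)
  qed
  from this[of UNIV A] show ?thesis using assms by simp
qed

text \<open>The Schur product theorem covers entrywise powers, hence the partial sums of the
  exponential series and their limit.\<close>

lemma psd_matrix_exp:
  assumes "psd_matrix A"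
  shows "psd_matrix (\<chi> i j. exp (A $ i $ j))"
proof (rule psd_matrix_LIMSEQ)
  have pow: "psd_matrix (\<chi> i j. A $ i $ j ^ k)" for k
  proof (induction k)
    case 0
    then show ?case using psd_matrix_one by simp
  next
    case (Suc k)
    from psd_matrix_Schur_product[OF assms this] show ?case by simp
  qed
  show "psd_matrix (\<chi> i j. \<Sum>k<n. A $ i $ j ^ k /\<^sub>R fact k)" for n
  proof (induction n)
    case 0
    then show ?case by (simp add: psd_matrix_iff)
  next
    case (Suc n)
    from psd_matrix_add[OF this psd_matrix_scale[OF pow[of n], of "inverse (fact n)"]]
    show ?case by simp
  qed
  show "(\<lambda>n. (\<chi> i j. \<Sum>k<n. A $ i $ j ^ k /\<^sub>R fact k) $ i $ j) \<longlonglongrightarrow> (\<chi> i j. exp (A $ i $ j)) $ i $ j"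
    for i j
    using exp_converges[of "A $ i $ j"] by (simp add: sums_def)
qed

text \<open>\<open>min (v i) (v j)\<close> is the length of the intersection of two intervals
  starting at 0, so the matrix is an integral of products of indicators.\<close>

lemma psd_matrix_min:
  fixes v :: "'n::finite \<Rightarrow> real"
  assumes "\<And>i. 0 \<le> v i"
  shows "psd_matrix (\<chi> i j. min (v i) (v j))"
proof (rule psd_matrix_has_integral)
  show "psd_matrix (\<chi> i j. indicat_real {0..v i} t * indicat_real {0..v j} t)" for t
    using psd_matrix_congruence[OF psd_matrix_one, of "\<lambda>i. indicat_real {0..v i} t"] by simp
next
  fix i j
  have "((\<lambda>t. 1) has_integral min (v i) (v j)) {0..min (v i) (v j)}"
    using has_integral_const_real[of "1::real" 0 "min (v i) (v j)"] assms by simp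
  then have "((\<lambda>t. if t \<in> {0..min (v i) (v j)} then 1 else 0) has_integral min (v i) (v j)) UNIV"
    by (simp only: has_integral_restrict_UNIV)
  moreover have "indicat_real {0..v i} t * indicat_real {0..v j} t
      = (if t \<in> {0..min (v i) (v j)} then 1 else 0)" for t
    by (simp add: indicator_def)
  ultimately show "((\<lambda>t. (\<chi> i j. indicat_real {0..v i} t * indicat_real {0..v j} t) $ i $ j)
      has_integral (\<chi> i j. min (v i) (v j)) $ i $ j) UNIV"
    by simp
qed

section \<open>Powers of conditionally negative definite matrices\<close>

text \<open>The Gamma integral under the substitution \<open>t \<mapsto> c * t\<close>.\<close>

lemma has_integral_powr_exp_scaled:
  fixes r c :: real
  assumes "0 < r" "0 < c"
  shows "((\<lambda>t. t powr (r - 1) * exp (- (t * c))) has_integral Gamma r * c powr - r) {0..}"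
proof -
  let ?f = "\<lambda>t::real. t powr (r - 1) / exp t"
  have im: "(\<lambda>t. c * t) ` {0..} = {0..}"
    using assms by (auto simp: image_iff intro!: bexI[of _ "_ / c"])
  have G: "(?f has_integral Gamma r) {0..}"
    by (rule Gamma_integral_real) fact
  \<comment> \<open>Nonnegativity gives the absolute integrability that the change of variables
    demands.\<close>
  then have "?f absolutely_integrable_on {0..}"
    by (intro nonnegative_absolutely_integrable_1) (auto simp: integrable_on_def)
  with G have "?f absolutely_integrable_on (\<lambda>t. c * t) ` {0..} \<and>
      integral ((\<lambda>t. c * t) ` {0..}) ?f = Gamma r"
    by (simp add: im integral_unique)
  moreover have "(\<lambda>t. \<bar>c\<bar> * ?f (c * t)) absolutely_integrable_on {0..} \<and>
      integral {0..} (\<lambda>t. \<bar>c\<bar> * ?f (c * t)) = Gamma r \<longleftrightarrow>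
      ?f absolutely_integrable_on (\<lambda>t. c * t) ` {0..} \<and> integral ((\<lambda>t. c * t) ` {0..}) ?f = Gamma r"
    by (rule has_absolute_integral_change_of_variables_1')
      (use assms in \<open>auto intro!: derivative_eq_intros simp: inj_on_def\<close>)
  ultimately have "((\<lambda>t. \<bar>c\<bar> * ?f (c * t)) has_integral Gamma r) {0..}"
    by (metis has_integral_integrable_integral set_lebesgue_integral_eq_integral(1))
  then have "((\<lambda>t. c powr - r * (\<bar>c\<bar> * ?f (c * t))) has_integral c powr - r * Gamma r) {0..}"
    by (rule has_integral_mult_right)
  then show ?thesis
    unfolding mult.commute[of "Gamma r"]
  proof (rule has_integral_eq[rotated])
    fix t :: real
    assume "t \<in> {0..}"
    then have "(c * t) powr (r - 1) = c powr (r - 1) * t powr (r - 1)"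
      using assms by (simp add: powr_mult)
    moreover have "c powr - r * c * c powr (r - 1) = 1"
      using assms by (simp add: powr_diff powr_minus)
    ultimately show "c powr - r * (\<bar>c\<bar> * ?f (c * t)) = t powr (r - 1) * exp (- (t * c))"
      using assms by (simp add: exp_minus mult_ac divide_inverse)
  qed
qed

text \<open>On vectors with coordinate sum 0 the \<open>u\<close> terms cancel, leaving minus the
  form of \<open>P\<close>; hence the base is conditionally negative definite.\<close>

lemma psd_matrix_powr_minus:
  fixes u :: "'n::finite \<Rightarrow> real" and P :: "real^'n^'n"
  assumes psd: "psd_matrix P" and pos: "\<And>i j. 0 < u i + u j - P $ i $ j" and r: "0 < r"
  shows "psd_matrix (\<chi> i j. (u i + u j - P $ i $ j) powr - r)"
proof -
  let ?F = "\<lambda>i j. u i + u j - P $ i $ j"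
  have "psd_matrix (\<chi> i j. Gamma r * ?F i j powr - r)"
  proof (rule psd_matrix_has_integral)
    fix t :: real
    assume "t \<in> {0..}"
    \<comment> \<open>The exponentials in \<open>u\<close> act as a diagonal congruence; the nested
      \<open>\<chi>\<close> terms match the closure lemmas.\<close>
    then have "psd_matrix (\<chi> i j. t powr (r - 1) * (\<chi> i j. exp (- (t * u i)) * exp (- (t * u j)) *
        (\<chi> i j. exp ((\<chi> i j. t * P $ i $ j) $ i $ j)) $ i $ j) $ i $ j)"
      by (intro psd_matrix_scale psd_matrix_congruence psd_matrix_exp psd) auto
    then show "psd_matrix (\<chi> i j. t powr (r - 1) * exp (- (t * ?F i j)))"
      by (simp add: algebra_simps flip: exp_add)
  qed (use has_integral_powr_exp_scaled r pos in auto)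
  from psd_matrix_scale[OF this, of "inverse (Gamma r)"] show ?thesis
    using Gamma_real_pos[OF r] by (simp flip: mult.assoc)
qed

lemma infinitely_divisible_inverse:
  fixes u :: "'n::finite \<Rightarrow> real" and P :: "real^'n^'n"
  assumes psd: "psd_matrix P" and pos: "\<And>i j. 0 < u i + u j - P $ i $ j"
  shows "infinitely_divisible (\<chi> i j. 1 / (u i + u j - P $ i $ j))"
  unfolding infinitely_divisible_def
proof (intro conjI allI impI)
  let ?E = "\<chi> i j. 1 / (u i + u j - P $ i $ j)"
  show "transpose ?E = ?E"
    using psd by (simp add: psd_matrix_iff transpose_def vec_eq_iff add.commute)
  show "0 \<le> ?E $ i $ j" for i j
    using pos[of i j] by simp
  fix r :: real
  assume "0 \<le> r"
  show "psd_matrix (entrywise_powr ?E r)"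
  proof (cases "r = 0")
    case True
    \<comment> \<open>As \<open>0 powr 0 = 0\<close>, nonzero entries are what turns the zeroth
      power into the all-ones matrix.\<close>
    have "u i + u j \<noteq> P $ i $ j" for i j
      using pos[of i j] by simp
    then show ?thesis using True psd_matrix_one by (simp add: entrywise_powr_def)
  next
    case False
    have "entrywise_powr ?E r = (\<chi> i j. (u i + u j - P $ i $ j) powr - r)"
      using pos by (simp add: entrywise_powr_def powr_minus_divide powr_divide vec_eq_iff less_imp_le)
    then show ?thesis
      using psd_matrix_powr_minus[OF psd pos, of r] False \<open>0 \<le> r\<close> by simp
  qed
qed

section \<open>The matrix \<open>F\<close> of a generalized Laplacian\<close>

text \<open>If \<open>S $ i $ i = 0\<close>, row and column \<open>i\<close> vanish, so by dimension
  the row space is the whole hyperplane of vectors with coordinate \<open>i\<close> zero. It then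
  contains another axis vector, which is not orthogonal to \<open>1\<close> although
  \<open>S *v 1 = 0\<close>.\<close>

lemma generalized_Laplacian_diag_pos:
  fixes S :: "real^'n^'n"
  assumes card: "CARD('n) \<ge> 2" and gL: "generalized_Laplacian S"
    and rank: "rank S = CARD('n) - 1"
  shows "0 < S $ i $ i"
proof -
  have psd: "psd_matrix S" and S1: "S *v 1 = 0"
    using gL by (auto simp: generalized_Laplacian_def)
  have "S $ i $ i \<noteq> 0"
  proof
    assume 0: "S $ i $ i = 0"
    let ?H = "{x. axis i (1::real) \<bullet> x = 0}"
    have "S $ k $ i = 0" for k
      using psd_matrix_row_eq_0[OF psd 0] psd by (metis psd_matrix_iff)
    then have "rows S \<subseteq> ?H"
      by (auto simp: rows_def row_def inner_axis')
    then have "span (rows S) \<subseteq> ?H"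
      by (simp add: span_minimal subspace_hyperplane)
    moreover have "dim ?H = dim (span (rows S))"
      using rank by (simp add: dim_hyperplane axis_eq_0_iff row_rank_def)
    ultimately have span: "span (rows S) = ?H"
      by (intro subspace_dim_equal) (auto simp: subspace_hyperplane)
    obtain j where "j \<noteq> i"
      using card by (metis card_2_iff' ex_card UNIV_I)
    then have "axis j 1 \<in> span (rows S)"
      unfolding span by (simp add: inner_axis_axis)
    from orthogonal_nullspace_rowspace[OF S1 this] show False
      by (simp add: orthogonal_def inner_axis)
  qed
  then show ?thesis
    using psd_matrix_diag_nonneg[OF psd, of i] by simp
qed

lemma F_matrix_eq:
  fixes S :: "real^'n^'n"
  assumes "transpose S = S"
  shows "F_matrix a b S $ i $ j = max (a\<^sup>2) (b\<^sup>2) * S $ i $ i + max (a\<^sup>2) (b\<^sup>2) * S $ j $ j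
    - (\<bar>a\<^sup>2 - b\<^sup>2\<bar> * min (S $ i $ i) (S $ j $ j) + 2 * a * b * S $ i $ j)"
proof -
  have symm: "S $ j $ i = S $ i $ j"
    using assms by (metis transpose_def vec_lambda_beta)
  \<comment> \<open>The term in \<open>S $ i $ j\<close> is common to both entries by symmetry. The
    remaining parts, with \<open>p = a\<^sup>2\<close> and \<open>q = b\<^sup>2\<close>, differ by
    \<open>(p - q) * (x - y)\<close>.\<close>
  have max: "max (p * x + q * y) (p * y + q * x) = max p q * x + max p q * y - \<bar>p - q\<bar> * min x y"
    for p q x y :: real
  proof -
    have max: "max u v = (u + v + \<bar>u - v\<bar>) / 2" and min: "min u v = (u + v - \<bar>u - v\<bar>) / 2"
      for u v :: real by auto
    have "\<bar>(p * x + q * y) - (p * y + q * x)\<bar> = \<bar>p - q\<bar> * \<bar>x - y\<bar>"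
      by (simp add: algebra_simps flip: abs_mult)
    then show ?thesis
      unfolding max min by (simp add: field_simps)
  qed
  show ?thesis
    unfolding F_matrix_def D_matrix_def
    using max[of "a\<^sup>2" "S $ i $ i" "b\<^sup>2" "S $ j $ j"] symm
    by (simp add: max_def split: if_splits)
qed

text \<open>The maximum dominates the mean of \<open>d\<^sub>i\<^sub>j\<close> and \<open>d\<^sub>j\<^sub>i\<close>, and \<open>2 S\<^sub>i\<^sub>j \<le> S\<^sub>i\<^sub>i + S\<^sub>j\<^sub>j\<close>.\<close>

lemma F_matrix_pos:
  fixes S :: "real^'n^'n"
  assumes psd: "psd_matrix S" and diag: "\<And>i. 0 < S $ i $ i"
    and ab: "0 < a" "0 < b" "a \<noteq> b"
  shows "0 < F_matrix a b S $ i $ j"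
proof -
  have symm: "S $ j $ i = S $ i $ j"
    using psd by (simp add: psd_matrix_iff)
  have "0 \<le> S $ i $ i - 2 * S $ i $ j + S $ j $ j"
    using psd_matrix_shift_axis[OF psd, of "axis i 1" "-1" j] symm
    by (simp add: inner_axis' matrix_vector_mult_basis column_def)
  then have "0 \<le> a * b * (S $ i $ i - 2 * S $ i $ j + S $ j $ j)"
    using ab by simp
  \<comment> \<open>Strictness comes from this term, which for \<open>i = j\<close> is all of
    \<open>F_matrix a b S $ i $ i\<close>; hence the use of \<open>a \<noteq> b\<close>.\<close>
  moreover have "0 < (a - b)\<^sup>2 / 2 * (S $ i $ i + S $ j $ j)"
    using ab diag[of i] diag[of j] by (intro mult_pos_pos) auto
  moreover have "(a - b)\<^sup>2 / 2 * (S $ i $ i + S $ j $ j) + a * b * (S $ i $ i - 2 * S $ i $ j + S $ j $ j)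
      = (D_matrix a b S $ i $ j + D_matrix a b S $ j $ i) / 2"
    by (simp add: D_matrix_def symm field_simps power2_eq_square)
  ultimately show ?thesis
    by (simp add: F_matrix_def max_def)
qed

theorem theorem3p1:
  fixes S :: "real^'n^'n" and a b :: real
  assumes "CARD('n) \<ge> 2"
    and "generalized_Laplacian S"
    and "a > 0" and "b > 0" and "a \<noteq> b"
    and "rank S = CARD('n) - 1"
  shows "(\<forall>i j. F_matrix a b S $ i $ j > 0) \<and>
         infinitely_divisible (\<chi> i j. 1 / (F_matrix a b S $ i $ j))"
proof -
  have psd: "psd_matrix S" and symm: "transpose S = S"
    using assms(2) by (auto simp: generalized_Laplacian_def)
  have diag: "0 < S $ i $ i" for i
    using generalized_Laplacian_diag_pos assms by blast
  have pos: "0 < F_matrix a b S $ i $ j" for i j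
    by (intro F_matrix_pos psd diag assms)
  let ?u = "\<lambda>i. max (a\<^sup>2) (b\<^sup>2) * S $ i $ i"
  define P where "P = (\<chi> i j. \<bar>a\<^sup>2 - b\<^sup>2\<bar> * min (S $ i $ i) (S $ j $ j) + 2 * a * b * S $ i $ j)"
  have "psd_matrix (\<chi> i j. (\<chi> i j. \<bar>a\<^sup>2 - b\<^sup>2\<bar> * (\<chi> i j. min (S $ i $ i) (S $ j $ j)) $ i $ j) $ i $ j
      + (\<chi> i j. 2 * a * b * S $ i $ j) $ i $ j)"
    using assms diag by (intro psd_matrix_add psd_matrix_scale psd_matrix_min psd) (auto intro: less_imp_le)
  then have P: "psd_matrix P"
    by (simp add: P_def)
  have F: "F_matrix a b S $ i $ j = ?u i + ?u j - P $ i $ j" for i j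
    by (simp add: F_matrix_eq[OF symm] P_def)
  show ?thesis
    using pos infinitely_divisible_inverse[OF P, of ?u] by (simp add: F)
qed

end
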